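(* Let $n\ge 1$ be an integer (of arbitrary parity) and set $k=\lfloor n/2\rfloor$. Then $$P_{\mathrm{VHSASM}} = P_{\mathrm{ASM}}\cap P_{\mathrm{VS}}\cap P_{\mathrm{HS}}\cap\{X\in\mathbb R^{n\times n} : x_{i,k+1}=x_{k+1,i}=(-1)^{i+1}\ \text{for all } i\in[n]\}.$$
   Context: $[n]=\{1,\dots,n\}$. An $n\times n$ alternating sign matrix (ASM) is an $n\times n$ matrix with entries in $\{0,1,-1\}$ such that in each row and each column the non-zero entries alternate in sign and the first and last non-zero entries are $1$ (so every row and column sums to $1$). $P_{\mathrm{ASM}}\subseteq\mathbb R^{n\times n}$ is the convex hull of all $n\times n$ ASMs. $P_{\mathrm{VS}}=\{X\in\mathbb R^{n\times n}: x_{i,j}=x_{i,n+1-j}\ \forall i,j\in[n]\}$ and $P_{\mathrm{HS}}=\{X\in\mathbb R^{n\times n}: x_{i,j}=x_{n+1-i,j}\ \forall i,j\in[n]\}$. A VHSASM (vertically and horizontally symmetric ASM) is an $n\times n$ ASM lying in $P_{\mathrm{VS}}\cap P_{\mathrm{HS}}$, and $P_{\mathrm{VHSASM}}$ is the convex hull in $\mathbb R^{n\times n}$ of all $n\times n$ VHSASMs (the empty set if there are none). *)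

theory Defs
  imports "HOL-Analysis.Analysis"
begin

text \<open>
  The space of real \<open>n \<times> n\<close> matrices is \<open>real^'n^'n\<close>, where the rows and columns are numbered
  by an enumeration \<open>e\<close> of the index type, i.e. \<open>bij_betw e {1..n} (UNIV :: 'n set)\<close>
  (which forces \<open>n = CARD('n)\<close>). The entry \<open>x\<^sub>i\<^sub>,\<^sub>j\<close> of \<open>X\<close> is \<open>X $ e i $ e j\<close>.
  The definitions below are meant for such \<open>n\<close> and \<open>e\<close> only.
\<close>

definition alternating :: "nat \<Rightarrow> (nat \<Rightarrow> real) \<Rightarrow> bool" where
  "alternating n v \<longleftrightarrow>
     (\<exists>i\<in>{1..n}. v i \<noteq> 0) \<and>
     (\<forall>i\<in>{1..n}. \<forall>j\<in>{1..n}. i < j \<and> v i \<noteq> 0 \<and> v j \<noteq> 0 \<and> (\<forall>l. i < l \<and> l < j \<longrightarrow> v l = 0)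
        \<longrightarrow> sgn (v j) = - sgn (v i)) \<and>
     (\<forall>i\<in>{1..n}. v i \<noteq> 0 \<and> (\<forall>l\<in>{1..n}. l < i \<longrightarrow> v l = 0) \<longrightarrow> v i = 1) \<and>
     (\<forall>i\<in>{1..n}. v i \<noteq> 0 \<and> (\<forall>l\<in>{1..n}. i < l \<longrightarrow> v l = 0) \<longrightarrow> v i = 1)"

definition ASM :: "nat \<Rightarrow> (nat \<Rightarrow> 'n::finite) \<Rightarrow> (real^'n^'n) set" where
  "ASM n e = {X.
     (\<forall>i\<in>{1..n}. \<forall>j\<in>{1..n}. X $ e i $ e j \<in> {0, 1, -1}) \<and>
     (\<forall>i\<in>{1..n}. alternating n (\<lambda>j. X $ e i $ e j)) \<and>
     (\<forall>j\<in>{1..n}. alternating n (\<lambda>i. X $ e i $ e j))}"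

definition P_ASM :: "nat \<Rightarrow> (nat \<Rightarrow> 'n::finite) \<Rightarrow> (real^'n^'n) set" where
  "P_ASM n e = convex hull (ASM n e)"

definition P_VS :: "nat \<Rightarrow> (nat \<Rightarrow> 'n::finite) \<Rightarrow> (real^'n^'n) set" where
  "P_VS n e = {X. \<forall>i\<in>{1..n}. \<forall>j\<in>{1..n}. X $ e i $ e j = X $ e i $ e (n + 1 - j)}"

definition P_HS :: "nat \<Rightarrow> (nat \<Rightarrow> 'n::finite) \<Rightarrow> (real^'n^'n) set" where
  "P_HS n e = {X. \<forall>i\<in>{1..n}. \<forall>j\<in>{1..n}. X $ e i $ e j = X $ e (n + 1 - i) $ e j}"

definition VHSASM :: "nat \<Rightarrow> (nat \<Rightarrow> 'n::finite) \<Rightarrow> (real^'n^'n) set" where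
  "VHSASM n e = ASM n e \<inter> (P_VS n e \<inter> P_HS n e)"

definition P_VHSASM :: "nat \<Rightarrow> (nat \<Rightarrow> 'n::finite) \<Rightarrow> (real^'n^'n) set" where
  "P_VHSASM n e = convex hull (VHSASM n e)"

end

theory Submission
  imports Defs
begin

text \<open>
  For odd \<open>n = 2k + 1\<close>, describe a matrix by its corner sums
  \<open>h i j = (\<Sum>a\<le>i. \<Sum>b\<le>j. x\<^sub>a\<^sub>,\<^sub>b)\<close>. Partial row and column sums are differences of adjacent corner
  sums, so every \<open>X\<close> in the right-hand side lies in the polytope of matrices for which these
  differences are in \<open>[0, 1]\<close>, which is compact and convex, and where symmetry and the prescribed
  middle row and column force \<open>h\<close> to be integral on the rows and columns \<open>0, k, k + 1, n\<close>. By
  Krein--Milman it remains to see that an extreme point of this polytope is integral, since an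
  integral point is a VHSASM. If some corner sum is not an integer, then
  adding and subtracting \<open>sin\<^sup>2 (\<pi> h) / \<pi>\<close>, with opposite signs on adjacent quadrants,
  exhibits \<open>X\<close> as a proper midpoint inside the polytope.
  For even \<open>n\<close> both sides are empty.
\<close>

section \<open>Partial sums of alternating sequences\<close>

definition psum :: "(nat \<Rightarrow> real) \<Rightarrow> nat \<Rightarrow> real" where
  "psum v j = (\<Sum>b\<in>{1..j}. v b)"

lemma psum_0 [simp]: "psum v 0 = 0"
  by (simp add: psum_def)

lemma psum_Suc [simp]: "psum v (Suc j) = psum v j + v (Suc j)"
  by (simp add: psum_def)

lemma psum_const:
  assumes "i \<le> j" and "\<And>l. i < l \<Longrightarrow> l \<le> j \<Longrightarrow> v l = 0"
  shows "psum v j = psum v i"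
  using assms by (induction j rule: dec_induct) auto

text \<open>The non-zero entries run 1, -1, 1, ..., so the running sum toggles between 0 and 1, and
  it ends at 1 because the last non-zero entry is 1.\<close>

lemma alternating_psum:
  assumes alt: "alternating n v" and v: "\<And>i. i \<in> {1..n} \<Longrightarrow> v i \<in> {0, 1, -1}"
  shows "j \<le> n \<Longrightarrow> psum v j \<in> {0, 1}" and "psum v n = 1"
proof -
  \<comment> \<open>\<open>last i j\<close> marks \<open>i\<close> as the position of the last
    non-zero entry among the first \<open>j\<close>; the value there determines the running
    sum.\<close>
  define last where "last i j \<longleftrightarrow> i \<in> {1..j} \<and> v i \<noteq> 0 \<and> (\<forall>l. i < l \<and> l \<le> j \<longrightarrow> v l = 0)" for i j
  have inv: "((\<forall>l\<in>{1..j}. v l = 0) \<and> psum v j = 0) \<or>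
      (\<exists>i. last i j \<and> v i = 1 \<and> psum v j = 1) \<or> (\<exists>i. last i j \<and> v i = -1 \<and> psum v j = 0)"
    if "j \<le> n" for j
    using that
  proof (induction j)
    case 0
    then show ?case by simp
  next
    case (Suc j)
    show ?case
    proof (cases "v (Suc j) = 0")
      case True
      have "last i (Suc j)" if "last i j" for i
        using that True by (auto simp: last_def le_Suc_eq)
      with Suc True show ?thesis by (fastforce simp: le_Suc_eq)
    next
      case False
      have l: "last (Suc j) (Suc j)" using False by (auto simp: last_def)
      have pm: "v (Suc j) = 1 \<or> v (Suc j) = -1" using v[of "Suc j"] False Suc.prems by auto
      have sg: "sgn (v (Suc j)) = - sgn (v i)" if "last i j" for i
        using alt that False Suc.prems unfolding alternating_def last_def by auto
      have "(\<forall>l\<in>{1..j}. v l = 0) \<Longrightarrow> v (Suc j) = 1"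
        using alt False Suc.prems unfolding alternating_def by auto
      then show ?thesis using Suc l pm sg by fastforce
    qed
  qed
  show "j \<le> n \<Longrightarrow> psum v j \<in> {0, 1}" using inv[of j] by auto
  have "\<exists>i\<in>{1..n}. v i \<noteq> 0" using alt unfolding alternating_def by auto
  moreover have "v i = 1" if "last i n" for i
    using alt that unfolding alternating_def last_def by auto
  ultimately show "psum v n = 1" using inv[of n] by fastforce
qed

text \<open>A walk on 0 and 1 that starts at 0 is constant across zero entries, so each non-zero
  entry must undo the preceding one. The first one leaves 0 and the last one arrives at the final
  value 1, hence both equal 1.\<close>

lemma psum_alternating:
  assumes p: "\<And>j. j \<le> n \<Longrightarrow> psum v j \<in> {0, 1}" and tot: "psum v n = 1"
  shows "alternating n v" and "i \<in> {1..n} \<Longrightarrow> v i \<in> {0, 1, -1}"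
proof -
  have step: "psum v i = psum v (i - 1) + v i" if "i \<in> {1..n}" for i
    using that by (cases i) auto
  show "i \<in> {1..n} \<Longrightarrow> v i \<in> {0, 1, -1}"
    using step[of i] p[of i] p[of "i - 1"] by fastforce
  show "alternating n v"
    unfolding alternating_def
  proof (intro conjI ballI impI)
    show "\<exists>i\<in>{1..n}. v i \<noteq> 0"
    proof (rule ccontr)
      assume "\<not> ?thesis"
      then have "psum v n = psum v 0" by (intro psum_const) auto
      with tot show False by simp
    qed
  next
    fix i j
    assume i: "i \<in> {1..n}" and j: "j \<in> {1..n}"
      and h: "i < j \<and> v i \<noteq> 0 \<and> v j \<noteq> 0 \<and> (\<forall>l. i < l \<and> l < j \<longrightarrow> v l = 0)"
    have "psum v (j - 1) = psum v i" using h by (intro psum_const) auto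
    then show "sgn (v j) = - sgn (v i)"
      using step[OF i] step[OF j] h p[of i] p[of j] p[of "i - 1"] i j by auto
  next
    fix i
    assume i: "i \<in> {1..n}" and h: "v i \<noteq> 0 \<and> (\<forall>l\<in>{1..n}. l < i \<longrightarrow> v l = 0)"
    have "psum v (i - 1) = psum v 0" using h i by (intro psum_const) auto
    then show "v i = 1" using step[OF i] p[of i] h i by auto
  next
    fix i
    assume i: "i \<in> {1..n}" and h: "v i \<noteq> 0 \<and> (\<forall>l\<in>{1..n}. i < l \<longrightarrow> v l = 0)"
    have "psum v n = psum v i" using h i by (intro psum_const) auto
    then show "v i = 1" using step[OF i] p[of "i - 1"] h i tot by auto
  qed
qed

lemma psum_reflect:
  assumes "\<And>j. j \<in> {1..n} \<Longrightarrow> v j = v (n + 1 - j)" and "j \<le> n"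
  shows "psum v (n - j) = psum v n - psum v j"
  using assms(2)
proof (induction j)
  case 0
  then show ?case by simp
next
  case (Suc j)
  have "psum v (n - j) = psum v (n - Suc j) + v (n - j)"
    using Suc.prems psum_Suc[of v "n - Suc j"] by (simp add: Suc_diff_Suc)
  moreover have "v (n - j) = v (Suc j)"
    using assms(1)[of "Suc j"] Suc.prems by auto
  ultimately show ?case using Suc by simp
qed

text \<open>Refutes the even case: the prescribed column would sum to 0.\<close>

lemma psum_minus_one_power: "psum (\<lambda>i. (-1) ^ (i + 1)) i = (if even i then 0 else 1)"
  by (induction i) auto

section \<open>Corner sums\<close>

definition corner :: "(nat \<Rightarrow> nat \<Rightarrow> real) \<Rightarrow> nat \<Rightarrow> nat \<Rightarrow> real" where
  "corner x i j = psum (\<lambda>a. psum (x a) j) i"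

lemma corner_0 [simp]: "corner x 0 j = 0" "corner x i 0 = 0"
  by (auto simp: corner_def psum_def)

lemma corner_Suc_row: "corner x (Suc i) j = corner x i j + psum (x (Suc i)) j"
  by (simp add: corner_def)

text \<open>Lets each statement about columns follow from its row version applied to the
  transpose.\<close>

lemma corner_transpose: "corner (\<lambda>i j. x j i) i j = corner x j i"
  unfolding corner_def psum_def by (rule sum.swap)

lemma corner_Suc_col: "corner x i (Suc j) = corner x i j + psum (\<lambda>a. x a (Suc j)) i"
  using corner_Suc_row[of "\<lambda>i j. x j i" j i] by (simp add: corner_transpose[of x])

lemma corner_add_mult: "corner (\<lambda>i j. x i j + c * y i j) i j = corner x i j + c * corner y i j"
  by (simp add: corner_def psum_def sum.distrib sum_distrib_left)

lemma corner_cong: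
  assumes "\<And>a b. a \<in> {1..i} \<Longrightarrow> b \<in> {1..j} \<Longrightarrow> x a b = y a b"
  shows "corner x i j = corner y i j"
  unfolding corner_def psum_def using assms by (intro sum.cong) auto

lemma entry_eq_corner:
  assumes "i \<ge> 1" "j \<ge> 1"
  shows "x i j = corner x i j - corner x (i - 1) j - corner x i (j - 1) + corner x (i - 1) (j - 1)"
  using assms by (cases i; cases j) (auto simp: corner_Suc_row)

text \<open>Mixed differences invert corner sums, so a perturbation designed on corner sums comes
  from an actual matrix.\<close>

lemma corner_mixed_difference:
  assumes "\<And>j. G 0 j = 0" "\<And>i. G i 0 = 0"
  shows "corner (\<lambda>i j. G i j - G (i - 1) j - G i (j - 1) + G (i - 1) (j - 1)) i j = G i j"
proof -
  have "psum (\<lambda>j. G i j - G (i - 1) j - G i (j - 1) + G (i - 1) (j - 1)) j = G i j - G (i - 1) j" for i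
    using assms by (induction j) auto
  then show ?thesis
    using assms by (simp add: corner_def, induction i) auto
qed

section \<open>The perturbing function\<close>

text \<open>The function \<open>bump\<close> is 1-Lipschitz and 1-periodic and vanishes exactly on the integers,
  so that \<open>x \<mapsto> x \<plusminus> bump x\<close> preserves the relation \<open>0 \<le> y - x \<le> 1\<close>.\<close>

definition bump :: "real \<Rightarrow> real" where
  "bump x = (sin (pi * x))\<^sup>2 / pi"

lemma bump_eq_0_iff: "bump x = 0 \<longleftrightarrow> x \<in> \<int>"
  using sin_times_pi_eq_0[of x] by (simp add: bump_def mult.commute)

lemma bump_of_nat_minus: "bump (real i - x) = bump x"
proof -
  have "sin (pi * (real i - x)) = - ((-1) ^ i * sin (pi * x))"
    by (simp add: right_diff_distrib sin_diff cos_npi2 sin_npi2)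
  then show ?thesis by (simp add: bump_def power_mult_distrib flip: power_mult)
qed

lemma bump_add_1: "bump (x + 1) = bump x"
  by (simp add: bump_def distrib_left sin_add)

text \<open>The factorisation of a difference of squared sines gives the Lipschitz constant pi for
  the squared sine of \<open>pi * x\<close>; the division by pi in \<open>bump\<close> normalises it
  to 1.\<close>

lemma bump_lipschitz: "\<bar>bump x - bump y\<bar> \<le> \<bar>x - y\<bar>"
proof -
  have eq: "(sin a)\<^sup>2 - (sin b)\<^sup>2 = sin (a + b) * sin (a - b)" for a b :: real
  proof -
    have "sin (a + b) * sin (a - b) = (sin a)\<^sup>2 * (cos b)\<^sup>2 - (cos a)\<^sup>2 * (sin b)\<^sup>2"
      by (simp add: sin_add sin_diff algebra_simps power2_eq_square)
    then show ?thesis by (simp add: cos_squared_eq algebra_simps)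
  qed
  have "\<bar>(sin (pi * x))\<^sup>2 - (sin (pi * y))\<^sup>2\<bar> \<le> 1 * \<bar>pi * x - pi * y\<bar>"
    unfolding eq abs_mult using abs_sin_x_le_abs_x by (intro mult_mono) auto
  also have "\<dots> = pi * \<bar>x - y\<bar>"
    by (simp add: abs_mult flip: right_diff_distrib)
  finally show ?thesis
    by (simp add: bump_def divide_simps mult.commute flip: diff_divide_distrib)
qed

lemma add_bump_diff:
  assumes "y - x \<in> {0..1}" "\<bar>c\<bar> \<le> 1"
  shows "(y + c * bump y) - (x + c * bump x) \<in> {0..1}"
proof -
  have b: "\<bar>c * (bump y - bump x)\<bar> \<le> \<bar>bump y - bump x\<bar>"
    using assms(2) by (simp add: abs_mult mult_left_le_one_le)
  have "\<bar>bump y - bump x\<bar> \<le> y - x" using bump_lipschitz[of y x] assms by auto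
  \<comment> \<open>By periodicity \<open>x\<close> may be replaced by \<open>x + 1\<close>, which
    turns the Lipschitz bound into a bound by the slack at the upper end.\<close>
  moreover have "\<bar>bump y - bump x\<bar> \<le> 1 - (y - x)"
    using bump_lipschitz[of y "x + 1"] assms by (auto simp: bump_add_1)
  ultimately have "\<bar>c * (bump y - bump x)\<bar> \<le> y - x" "\<bar>c * (bump y - bump x)\<bar> \<le> 1 - (y - x)"
    using b by linarith+
  then show ?thesis by (auto simp: algebra_simps)
qed

section \<open>The polytope in corner-sum coordinates\<close>

text \<open>The first two conditions bound partial row and column sums, the next two encode symmetry
  and total sums. For the last two: a symmetric row of sum 1 with middle entry 1 or -1 has left half
  of sum 0 or 1, so the first \<open>i\<close> rows contribute \<open>i div 2\<close>.\<close>

definition vhs_corner :: "nat \<Rightarrow> (nat \<Rightarrow> nat \<Rightarrow> real) \<Rightarrow> bool" where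
  "vhs_corner k h \<longleftrightarrow>
     (\<forall>i j. i < 2*k+1 \<longrightarrow> j \<le> 2*k+1 \<longrightarrow> h (Suc i) j - h i j \<in> {0..1}) \<and>
     (\<forall>i j. i \<le> 2*k+1 \<longrightarrow> j < 2*k+1 \<longrightarrow> h i (Suc j) - h i j \<in> {0..1}) \<and>
     (\<forall>i j. i \<le> 2*k+1 \<longrightarrow> j \<le> 2*k+1 \<longrightarrow> h i (2*k+1 - j) = real i - h i j) \<and>
     (\<forall>i j. i \<le> 2*k+1 \<longrightarrow> j \<le> 2*k+1 \<longrightarrow> h (2*k+1 - i) j = real j - h i j) \<and>
     (\<forall>i. i \<le> 2*k+1 \<longrightarrow> h i k = real (i div 2)) \<and>
     (\<forall>i. i \<le> 2*k+1 \<longrightarrow> h k i = real (i div 2))"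

lemma vhs_cornerI:
  assumes "\<And>i j. i < 2*k+1 \<Longrightarrow> j \<le> 2*k+1 \<Longrightarrow> h (Suc i) j - h i j \<in> {0..1}"
    and "\<And>i j. i \<le> 2*k+1 \<Longrightarrow> j < 2*k+1 \<Longrightarrow> h i (Suc j) - h i j \<in> {0..1}"
    and "\<And>i j. i \<le> 2*k+1 \<Longrightarrow> j \<le> 2*k+1 \<Longrightarrow> h i (2*k+1 - j) = real i - h i j"
    and "\<And>i j. i \<le> 2*k+1 \<Longrightarrow> j \<le> 2*k+1 \<Longrightarrow> h (2*k+1 - i) j = real j - h i j"
    and "\<And>i. i \<le> 2*k+1 \<Longrightarrow> h i k = real (i div 2)"
    and "\<And>i. i \<le> 2*k+1 \<Longrightarrow> h k i = real (i div 2)"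
  shows "vhs_corner k h"
  unfolding vhs_corner_def by (intro conjI allI impI; rule assms)

lemma vhs_cornerD:
  assumes "vhs_corner k h"
  shows "i < 2*k+1 \<Longrightarrow> j \<le> 2*k+1 \<Longrightarrow> h (Suc i) j - h i j \<in> {0..1}"
    and "i \<le> 2*k+1 \<Longrightarrow> j < 2*k+1 \<Longrightarrow> h i (Suc j) - h i j \<in> {0..1}"
    and "i \<le> 2*k+1 \<Longrightarrow> j \<le> 2*k+1 \<Longrightarrow> h i (2*k+1 - j) = real i - h i j"
    and "i \<le> 2*k+1 \<Longrightarrow> j \<le> 2*k+1 \<Longrightarrow> h (2*k+1 - i) j = real j - h i j"
    and "i \<le> 2*k+1 \<Longrightarrow> h i k = real (i div 2)"
    and "i \<le> 2*k+1 \<Longrightarrow> h k i = real (i div 2)"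
proof -
  note h = assms[unfolded vhs_corner_def]
  note h2 = h[THEN conjunct2]
  note h3 = h2[THEN conjunct2]
  note h4 = h3[THEN conjunct2]
  note h5 = h4[THEN conjunct2]
  show "i < 2*k+1 \<Longrightarrow> j \<le> 2*k+1 \<Longrightarrow> h (Suc i) j - h i j \<in> {0..1}"
    by (rule h[THEN conjunct1, rule_format])
  show "i \<le> 2*k+1 \<Longrightarrow> j < 2*k+1 \<Longrightarrow> h i (Suc j) - h i j \<in> {0..1}"
    by (rule h2[THEN conjunct1, rule_format])
  show "i \<le> 2*k+1 \<Longrightarrow> j \<le> 2*k+1 \<Longrightarrow> h i (2*k+1 - j) = real i - h i j"
    by (rule h3[THEN conjunct1, rule_format])
  show "i \<le> 2*k+1 \<Longrightarrow> j \<le> 2*k+1 \<Longrightarrow> h (2*k+1 - i) j = real j - h i j"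
    by (rule h4[THEN conjunct1, rule_format])
  show "i \<le> 2*k+1 \<Longrightarrow> h i k = real (i div 2)"
    by (rule h5[THEN conjunct1, rule_format])
  show "i \<le> 2*k+1 \<Longrightarrow> h k i = real (i div 2)"
    by (rule h5[THEN conjunct2, rule_format])
qed

text \<open>Needed because the perturbing matrix has the intended corner sums only for indices up to
  \<open>2*k+1\<close>.\<close>

lemma vhs_corner_cong:
  assumes "\<And>i j. i \<le> 2*k+1 \<Longrightarrow> j \<le> 2*k+1 \<Longrightarrow> h i j = h' i j" and "vhs_corner k h"
  shows "vhs_corner k h'"
proof (rule vhs_cornerI)
  note D = vhs_cornerD[OF assms(2)]
  fix i j
  show "h' (Suc i) j - h' i j \<in> {0..1}" if "i < 2*k+1" "j \<le> 2*k+1"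
    using D(1)[OF that] that by (simp flip: assms(1))
  show "h' i (Suc j) - h' i j \<in> {0..1}" if "i \<le> 2*k+1" "j < 2*k+1"
    using D(2)[OF that] that by (simp flip: assms(1))
  show "h' i (2*k+1 - j) = real i - h' i j" if "i \<le> 2*k+1" "j \<le> 2*k+1"
    using D(3)[OF that] that by (simp flip: assms(1))
  show "h' (2*k+1 - i) j = real j - h' i j" if "i \<le> 2*k+1" "j \<le> 2*k+1"
    using D(4)[OF that] that by (simp flip: assms(1))
  show "h' i k = real (i div 2)" if "i \<le> 2*k+1"
    using D(5)[OF that] that by (simp flip: assms(1))
  show "h' k i = real (i div 2)" if "i \<le> 2*k+1"
    using D(6)[OF that] that by (simp flip: assms(1))
qed

lemma vhs_corner_convex:
  assumes "vhs_corner k h" "vhs_corner k h'" "0 \<le> u" "0 \<le> w" "u + w = 1"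
  shows "vhs_corner k (\<lambda>i j. u * h i j + w * h' i j)"
proof -
  note D = vhs_cornerD[OF assms(1)] and D' = vhs_cornerD[OF assms(2)]
  have w: "w = 1 - u" using assms by simp
  \<comment> \<open>Each defining condition has one of three shapes, all stable under convex
    combination: a difference in the unit interval, a reflection, a fixed value.\<close>
  have seg: "(u * a + w * a') - (u * b + w * b') \<in> {0..1}"
    if "a - b \<in> {0..1}" "a' - b' \<in> {0..1}" for a b a' b' :: real
    using convexD[OF convex_real_interval(5) that assms(3-5)] by (simp add: algebra_simps)
  have refl: "u * a + w * a' = r - (u * b + w * b')" if "a = r - b" "a' = r - b'" for a a' b b' r :: real
    by (simp add: that w algebra_simps)
  have const: "u * a + w * a' = r" if "a = r" "a' = r" for a a' r :: real
    by (simp add: that w algebra_simps)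
  show ?thesis
    by (rule vhs_cornerI)
      (rule seg[OF D(1) D'(1)] seg[OF D(2) D'(2)] refl[OF D(3) D'(3)] refl[OF D(4) D'(4)]
        const[OF D(5) D'(5)] const[OF D(6) D'(6)]; assumption)+
qed

text \<open>The signs compensate for the symmetry \<open>h i (n - j) = i - h i j\<close>: a perturbation of \<open>h\<close> that
  preserves it has to be odd under the reflection, whereas \<open>bump\<close> is even.\<close>

definition signed_bump :: "nat \<Rightarrow> (nat \<Rightarrow> nat \<Rightarrow> real) \<Rightarrow> nat \<Rightarrow> nat \<Rightarrow> real" where
  "signed_bump k h i j = (if i \<le> k then 1 else -1) * (if j \<le> k then 1 else -1) * bump (h i j)"

text \<open>Within a quadrant the sign is constant and \<open>add_bump_diff\<close> applies. Across
  the border of two quadrants the sign jumps, but there \<open>h\<close> is integral and the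
  perturbation vanishes on both sides.\<close>

lemma vhs_corner_perturb:
  assumes h: "vhs_corner k h" and c: "\<bar>c\<bar> \<le> 1"
  shows "vhs_corner k (\<lambda>i j. h i j + c * signed_bump k h i j)"
proof -
  define s :: "nat \<Rightarrow> real" where "s i = (if i \<le> k then 1 else -1)" for i
  have G: "signed_bump k h i j = s i * s j * bump (h i j)" for i j
    by (simp add: signed_bump_def s_def)
  have abs_c: "\<bar>c * s i * s j\<bar> \<le> 1" for i j
    using c by (auto simp: s_def)
  have s_flip: "s (2*k+1 - i) = - s i" if "i \<le> 2*k+1" for i
    using that by (auto simp: s_def)
  have mid: "h i k = real (i div 2)" "h k i = real (i div 2)" if "i \<le> 2*k+1" for i
    using that by (rule vhs_cornerD[OF h])+
  have refl: "h i (2*k+1 - j) = real i - h i j" "h (2*k+1 - i) j = real j - h i j"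
    if "i \<le> 2*k+1" "j \<le> 2*k+1" for i j
    using that by (rule vhs_cornerD[OF h])+
  \<comment> \<open>The reflection of \<open>k\<close> in \<open>2*k+1\<close> is
    \<open>k+1\<close>, so integrality passes to row and column \<open>k+1\<close>.\<close>
  have mid': "h i (Suc k) = real i - real (i div 2)" "h (Suc k) i = real i - real (i div 2)"
    if "i \<le> 2*k+1" for i
    using refl(1)[of i k] refl(2)[of k i] mid that by auto
  have G_mid: "signed_bump k h i k = 0" "signed_bump k h k i = 0"
    "signed_bump k h i (Suc k) = 0" "signed_bump k h (Suc k) i = 0" if "i \<le> 2*k+1" for i
    using that by (auto simp: G mid mid' bump_eq_0_iff)
  have G_refl: "signed_bump k h i (2*k+1 - j) = - signed_bump k h i j"
    "signed_bump k h (2*k+1 - i) j = - signed_bump k h i j" if "i \<le> 2*k+1" "j \<le> 2*k+1" for i j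
    unfolding G refl[OF that] s_flip[OF that(1)] s_flip[OF that(2)] bump_of_nat_minus by auto
  have row: "(h (Suc i) j + c * signed_bump k h (Suc i) j) - (h i j + c * signed_bump k h i j) \<in> {0..1}"
    if "i < 2*k+1" "j \<le> 2*k+1" for i j
  proof -
    have d: "h (Suc i) j - h i j \<in> {0..1}" using that by (rule vhs_cornerD[OF h])
    show ?thesis
    proof (cases "i = k")
      case True
      then show ?thesis using d that by (simp add: G_mid)
    next
      case False
      then have "s (Suc i) = s i" by (auto simp: s_def)
      then show ?thesis using add_bump_diff[OF d abs_c[of i j]] by (simp add: G mult.assoc)
    qed
  qed
  have col: "(h i (Suc j) + c * signed_bump k h i (Suc j)) - (h i j + c * signed_bump k h i j) \<in> {0..1}"
    if "i \<le> 2*k+1" "j < 2*k+1" for i j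
  proof -
    have d: "h i (Suc j) - h i j \<in> {0..1}" using that by (rule vhs_cornerD[OF h])
    show ?thesis
    proof (cases "j = k")
      case True
      then show ?thesis using d that by (simp add: G_mid)
    next
      case False
      then have "s (Suc j) = s j" by (auto simp: s_def)
      then show ?thesis using add_bump_diff[OF d abs_c[of i j]] by (simp add: G mult.assoc)
    qed
  qed
  show ?thesis
    by (rule vhs_cornerI; (rule row col)?) (use refl G_refl mid G_mid in \<open>simp_all\<close>)
qed

section \<open>Matrices, partial sums and symmetry\<close>

definition entry :: "(nat \<Rightarrow> 'n::finite) \<Rightarrow> real^'n^'n \<Rightarrow> nat \<Rightarrow> nat \<Rightarrow> real" where
  "entry e X i j = X $ e i $ e j"

text \<open>These are the conditions of \<open>P_ASM_psum\<close> with the unit interval replaced by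
  its endpoints, so integrality of the partial sums is all that separates the two.\<close>

lemma ASM_iff:
  "X \<in> ASM n e \<longleftrightarrow>
     (\<forall>i\<in>{1..n}. (\<forall>j\<le>n. psum (entry e X i) j \<in> {0, 1}) \<and> psum (entry e X i) n = 1) \<and>
     (\<forall>j\<in>{1..n}. (\<forall>i\<le>n. psum (\<lambda>i. entry e X i j) i \<in> {0, 1}) \<and> psum (\<lambda>i. entry e X i j) n = 1)"
  (is "_ \<longleftrightarrow> ?rows \<and> ?cols")
proof
  assume X: "X \<in> ASM n e"
  have "?rows"
    using X alternating_psum[of n "entry e X i" for i] unfolding ASM_def entry_def by blast
  moreover have "?cols"
    using X alternating_psum[of n "\<lambda>i. entry e X i j" for j] unfolding ASM_def entry_def by blast
  ultimately show "?rows \<and> ?cols" ..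
next
  assume rc: "?rows \<and> ?cols"
  have "entry e X i j \<in> {0, 1, -1}" if "i \<in> {1..n}" "j \<in> {1..n}" for i j
    using rc psum_alternating(2)[of n "entry e X i" j] that by blast
  moreover have "alternating n (entry e X i)" if "i \<in> {1..n}" for i
    using rc psum_alternating(1)[of n "entry e X i"] that by blast
  moreover have "alternating n (\<lambda>i. entry e X i j)" if "j \<in> {1..n}" for j
    using rc psum_alternating(1)[of n "\<lambda>i. entry e X i j"] that by blast
  ultimately show "X \<in> ASM n e" unfolding ASM_def entry_def by blast
qed

lemma P_ASM_psum:
  assumes "X \<in> P_ASM n e"
  shows "i \<in> {1..n} \<Longrightarrow> j \<le> n \<Longrightarrow> psum (entry e X i) j \<in> {0..1}"
    and "j \<in> {1..n} \<Longrightarrow> i \<le> n \<Longrightarrow> psum (\<lambda>i. entry e X i j) i \<in> {0..1}"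
    and "i \<in> {1..n} \<Longrightarrow> psum (entry e X i) n = 1"
    and "j \<in> {1..n} \<Longrightarrow> psum (\<lambda>i. entry e X i j) n = 1"
proof -
  \<comment> \<open>The preimage of a convex set under a linear functional is convex, so if it
    contains every ASM it contains their hull.\<close>
  have hull: "f X \<in> S" if "linear f" "convex S" "\<And>Y. Y \<in> ASM n e \<Longrightarrow> f Y \<in> S"
    for f :: "real^'a^'a \<Rightarrow> real" and S
  proof -
    have "P_ASM n e \<subseteq> f -` S"
      unfolding P_ASM_def using that by (intro hull_minimal convex_linear_vimage) auto
    with assms show ?thesis by auto
  qed
  have lin: "linear (\<lambda>Y. psum (entry e Y i) j)" "linear (\<lambda>Y. psum (\<lambda>i. entry e Y i j) i)" for i j
    by (rule linearI; simp add: psum_def entry_def sum.distrib sum_distrib_left)+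
  have asm: "psum (entry e Y i) j \<in> {0, 1}" "psum (\<lambda>i. entry e Y i i') j \<in> {0, 1}"
      "psum (entry e Y i) n = 1" "psum (\<lambda>i. entry e Y i i') n = 1"
    if "Y \<in> ASM n e" "i \<in> {1..n}" "i' \<in> {1..n}" "j \<le> n" for Y :: "real^'a^'a" and i i' j
    using that unfolding ASM_iff by blast+
  have sub: "{0, 1} \<subseteq> {0..1::real}" by auto
  show "psum (entry e X i) j \<in> {0..1}" if "i \<in> {1..n}" "j \<le> n"
    using hull[OF lin(1) convex_real_interval(5)] asm(1) that sub by blast
  show "psum (\<lambda>i. entry e X i j) i \<in> {0..1}" if "j \<in> {1..n}" "i \<le> n"
    using hull[OF lin(2) convex_real_interval(5)] asm(2) that sub by blast
  show "psum (entry e X i) n = 1" if "i \<in> {1..n}"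
    using hull[OF lin(1)[of i n] convex_singleton[of 1]] asm(3) that by blast
  show "psum (\<lambda>i. entry e X i j) n = 1" if "j \<in> {1..n}"
    using hull[OF lin(2)[of j n] convex_singleton[of 1]] asm(4) that by blast
qed

text \<open>The second line quantifies over columns first, so that it is the first line for the
  transpose.\<close>

lemma symmetric_entry:
  "X \<in> P_VS n e \<longleftrightarrow> (\<forall>i\<in>{1..n}. \<forall>j\<in>{1..n}. entry e X i j = entry e X i (n + 1 - j))"
  "X \<in> P_HS n e \<longleftrightarrow> (\<forall>j\<in>{1..n}. \<forall>i\<in>{1..n}. entry e X i j = entry e X (n + 1 - i) j)"
  by (auto simp: P_VS_def P_HS_def entry_def)

lemma psum_half:
  assumes "\<And>j. j \<in> {1..2*k+1} \<Longrightarrow> v j = v (2*k+1 + 1 - j)" and "psum v (2*k+1) = 1"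
  shows "v (Suc k) = 1 - 2 * psum v k"
  using psum_reflect[of "2*k+1" v k, OF assms(1)] assms(2) by simp

lemma corner_reflect_col:
  assumes row: "\<And>i. i \<in> {1..n} \<Longrightarrow> psum (x i) n = 1"
    and sym: "\<And>i j. i \<in> {1..n} \<Longrightarrow> j \<in> {1..n} \<Longrightarrow> x i j = x i (n + 1 - j)"
    and "i \<le> n" "j \<le> n"
  shows "corner x i (n - j) = real i - corner x i j"
  using assms(3)
proof (induction i)
  case 0
  then show ?case by simp
next
  case (Suc i)
  have "psum (x (Suc i)) (n - j) = 1 - psum (x (Suc i)) j"
    using psum_reflect[of n "x (Suc i)" j, OF sym] row[of "Suc i"] Suc.prems assms(4) by simp
  then show ?case using Suc by (simp add: corner_Suc_row)
qed

text \<open>By \<open>psum_half\<close> the prescribed middle entry fixes the left half of row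
  \<open>i\<close>: sum 0 for odd \<open>i\<close> and 1 for even \<open>i\<close>.\<close>

lemma corner_half_col:
  assumes row: "\<And>i. i \<in> {1..2*k+1} \<Longrightarrow> psum (x i) (2*k+1) = 1"
    and sym: "\<And>i j. i \<in> {1..2*k+1} \<Longrightarrow> j \<in> {1..2*k+1} \<Longrightarrow> x i j = x i (2*k+1 + 1 - j)"
    and mid: "\<And>i. i \<in> {1..2*k+1} \<Longrightarrow> x i (k + 1) = (-1) ^ (i + 1)"
    and "i \<le> 2*k+1"
  shows "corner x i k = real (i div 2)"
  using assms(4)
proof (induction i)
  case 0
  then show ?case by simp
next
  case (Suc i)
  have "x (Suc i) (Suc k) = 1 - 2 * psum (x (Suc i)) k"
    by (rule psum_half; (rule row sym)?) (use Suc.prems in auto)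
  moreover have "x (Suc i) (Suc k) = (-1) ^ i"
    using mid[of "Suc i"] Suc.prems by simp
  ultimately have "psum (x (Suc i)) k = (1 - (-1) ^ i) / 2"
    by simp
  moreover have "real (Suc i div 2) = real (i div 2) + (1 - (-1) ^ i) / 2"
    by (cases "even i") auto
  ultimately show ?case using Suc by (simp add: corner_Suc_row)
qed

text \<open>Symmetry makes each middle entry 1 minus twice 0 or 1, hence never zero. The partial
  sums of the middle column then toggle at every step, which forces the signs.\<close>

lemma symmetric_alternating_middle:
  assumes row: "\<And>i. i \<in> {1..2*k+1} \<Longrightarrow> psum (x i) (2*k+1) = 1 \<and> psum (x i) k \<in> {0, 1}"
    and sym: "\<And>i j. i \<in> {1..2*k+1} \<Longrightarrow> j \<in> {1..2*k+1} \<Longrightarrow> x i j = x i (2*k+1 + 1 - j)"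
    and col: "\<And>i. i \<le> 2*k+1 \<Longrightarrow> psum (\<lambda>i. x i (k + 1)) i \<in> {0, 1}"
    and i: "i \<in> {1..2*k+1}"
  shows "x i (k + 1) = (-1) ^ (i + 1)"
proof -
  have pm: "x i (k + 1) \<in> {1, -1}" if "i \<in> {1..2*k+1}" for i
    using psum_half[of k "x i", OF sym] row[OF that] that by auto
  have p: "psum (\<lambda>i. x i (k + 1)) i = (if even i then 0 else 1)" if "i \<le> 2*k+1" for i
    using that
  proof (induction i)
    case 0
    then show ?case by simp
  next
    case (Suc i)
    then show ?case using pm[of "Suc i"] col[of "Suc i"] by auto
  qed
  obtain a where a: "i = Suc a" using i by (cases i) auto
  show ?thesis using p[of i] p[of a] i a by (auto split: if_splits)
qed

section \<open>The polytope of matrices and its extreme points\<close>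

definition vhs_set :: "nat \<Rightarrow> (nat \<Rightarrow> 'n::finite) \<Rightarrow> (real^'n^'n) set" where
  "vhs_set k e = {X. vhs_corner k (corner (entry e X))}"

lemma entry_add_scaleR: "entry e (X + c *\<^sub>R Y) = (\<lambda>i j. entry e X i j + c * entry e Y i j)"
  by (simp add: entry_def fun_eq_iff)

lemma convex_vhs_set: "convex (vhs_set k e)"
proof (rule convexI)
  fix X Y :: "real^'a^'a" and u w :: real
  assume *: "X \<in> vhs_set k e" "Y \<in> vhs_set k e" "0 \<le> u" "0 \<le> w" "u + w = 1"
  have "corner (entry e (u *\<^sub>R X + w *\<^sub>R Y)) i j = u * corner (entry e X) i j + w * corner (entry e Y) i j" for i j
    by (simp add: corner_def psum_def entry_def sum.distrib sum_distrib_left)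
  then have "corner (entry e (u *\<^sub>R X + w *\<^sub>R Y)) =
      (\<lambda>i j. u * corner (entry e X) i j + w * corner (entry e Y) i j)"
    by blast
  then show "u *\<^sub>R X + w *\<^sub>R Y \<in> vhs_set k e"
    using vhs_corner_convex[OF _ _ *(3-5)] *(1,2) unfolding vhs_set_def by simp
qed

lemma closed_vhs_set: "closed (vhs_set k e)"
proof -
  have c: "continuous_on UNIV (\<lambda>X. corner (entry e X) i j)" for i j
    unfolding corner_def psum_def entry_def by (intro continuous_intros)
  show ?thesis
    unfolding vhs_set_def vhs_corner_def atLeastAtMost_iff
    by (intro closed_Collect_conj closed_Collect_all closed_Collect_imp open_Collect_const
        closed_Collect_le closed_Collect_eq continuous_intros c)
qed

lemma vhs_corner_psum:
  assumes h: "vhs_corner k (corner x)"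
  shows "i \<in> {1..2*k+1} \<Longrightarrow> j \<le> 2*k+1 \<Longrightarrow> psum (x i) j \<in> {0..1}"
    and "j \<in> {1..2*k+1} \<Longrightarrow> i \<le> 2*k+1 \<Longrightarrow> psum (\<lambda>i. x i j) i \<in> {0..1}"
    and "i \<in> {1..2*k+1} \<Longrightarrow> psum (x i) (2*k+1) = 1"
    and "j \<in> {1..2*k+1} \<Longrightarrow> psum (\<lambda>i. x i j) (2*k+1) = 1"
proof -
  have row: "psum (x i) j = corner x i j - corner x (i - 1) j" if "i \<ge> 1" for i j
    using that by (cases i) (auto simp: corner_Suc_row)
  have col: "psum (\<lambda>i. x i j) i = corner x i j - corner x i (j - 1)" if "j \<ge> 1" for i j
    using that by (cases j) (auto simp: corner_Suc_col)
  \<comment> \<open>Reflecting column 0 or row 0, where corner sums vanish, gives the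
    totals.\<close>
  have tot: "corner x i (2*k+1) = real i" "corner x (2*k+1) i = real i" if "i \<le> 2*k+1" for i
  proof -
    show "corner x i (2*k+1) = real i" using vhs_cornerD(3)[OF h, where i = i and j = 0] that by simp
    show "corner x (2*k+1) i = real i" using vhs_cornerD(4)[OF h, where i = 0 and j = i] that by simp
  qed
  show "psum (x i) j \<in> {0..1}" if "i \<in> {1..2*k+1}" "j \<le> 2*k+1"
  proof -
    have "i - 1 < 2*k+1" "Suc (i - 1) = i" using that by auto
    then show ?thesis using vhs_cornerD(1)[OF h, where i = "i - 1" and j = j] that row[of i j] by simp
  qed
  show "psum (\<lambda>i. x i j) i \<in> {0..1}" if "j \<in> {1..2*k+1}" "i \<le> 2*k+1"
  proof -
    have "j - 1 < 2*k+1" "Suc (j - 1) = j" using that by auto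
    then show ?thesis using vhs_cornerD(2)[OF h, where i = i and j = "j - 1"] that col[of j i] by simp
  qed
  show "psum (x i) (2*k+1) = 1" if "i \<in> {1..2*k+1}"
    using that row[of i "2*k+1"] tot(1)[of i] tot(1)[of "i - 1"] by (cases i) auto
  show "psum (\<lambda>i. x i j) (2*k+1) = 1" if "j \<in> {1..2*k+1}"
    using that col[of j "2*k+1"] tot(2)[of j] tot(2)[of "j - 1"] by (cases j) auto
qed

text \<open>Every entry is a difference of two partial row sums in the unit interval, so it has
  absolute value at most 1.\<close>

lemma bounded_vhs_set:
  fixes e :: "nat \<Rightarrow> 'n::finite"
  assumes e: "bij_betw e {1..2*k+1} (UNIV :: 'n set)"
  shows "bounded (vhs_set k e)"
proof -
  have "norm X \<le> (\<Sum>a\<in>(UNIV :: 'n set). \<Sum>b\<in>(UNIV :: 'n set). 1)" if X: "X \<in> vhs_set k e" for X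
  proof -
    have "\<bar>X $ a $ b\<bar> \<le> 1" for a b
    proof -
      have "a \<in> e ` {1..2*k+1}" "b \<in> e ` {1..2*k+1}"
        using bij_betw_imp_surj_on[OF e] by simp_all
      then obtain i j where ij: "i \<in> {1..2*k+1}" "j \<in> {1..2*k+1}" "a = e i" "b = e j"
        by blast
      have "psum (entry e X i) j = psum (entry e X i) (j - 1) + X $ a $ b"
        using ij by (cases j) (auto simp: entry_def)
      moreover have bnd: "psum (entry e X i) j' \<in> {0..1}" if "j' \<le> 2*k+1" for j'
        using X ij(1) that unfolding vhs_set_def mem_Collect_eq by (rule vhs_corner_psum(1))
      moreover have "psum (entry e X i) j \<in> {0..1}" "psum (entry e X i) (j - 1) \<in> {0..1}"
        using ij(2) bnd[of j] bnd[of "j - 1"] by (cases j; simp)+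
      ultimately show ?thesis by auto
    qed
    then have "norm (X $ a) \<le> (\<Sum>b\<in>(UNIV :: 'n set). 1)" for a
      by (intro order_trans[OF norm_le_l1_cart] sum_mono) simp
    moreover have "norm X \<le> (\<Sum>a\<in>UNIV. norm (X $ a))"
      unfolding norm_vec_def by (rule L2_set_le_sum) simp
    ultimately show ?thesis by (meson order_trans sum_mono)
  qed
  then show ?thesis unfolding bounded_iff by blast
qed

lemma extreme_point_vhs_set:
  fixes e :: "nat \<Rightarrow> 'n::finite"
  assumes e: "bij_betw e {1..2*k+1} (UNIV :: 'n set)" and X: "X extreme_point_of vhs_set k e"
  shows "X \<in> VHSASM (2*k+1) e"
proof -
  define h where "h = corner (entry e X)"
  define G where "G i j = signed_bump k h i j" for i j
  \<comment> \<open>\<open>D\<close> is the matrix with corner sums \<open>G\<close>;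
    \<open>the_inv_into\<close> recovers the number of a row or column from its index.\<close>
  define D :: "real^'n^'n" where "D = (\<chi> a b. let i = the_inv_into {1..2*k+1} e a;
      j = the_inv_into {1..2*k+1} e b in G i j - G (i - 1) j - G i (j - 1) + G (i - 1) (j - 1))"
  have h: "vhs_corner k h"
    using X by (auto simp: extreme_point_of_def vhs_set_def h_def)
  have G0: "G 0 j = 0" "G i 0 = 0" for i j
    by (auto simp: G_def signed_bump_def h_def bump_eq_0_iff)
  have "entry e D i j = G i j - G (i - 1) j - G i (j - 1) + G (i - 1) (j - 1)"
    if "i \<in> {1..2*k+1}" "j \<in> {1..2*k+1}" for i j
    unfolding entry_def D_def using that e the_inv_into_f_f[of e "{1..2*k+1}"]
    by (simp add: bij_betw_def)
  then have "corner (entry e D) i j =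
      corner (\<lambda>i j. G i j - G (i - 1) j - G i (j - 1) + G (i - 1) (j - 1)) i j"
    if "i \<le> 2*k+1" "j \<le> 2*k+1" for i j
    using that by (intro corner_cong) auto
  then have cD: "corner (entry e D) i j = G i j" if "i \<le> 2*k+1" "j \<le> 2*k+1" for i j
    using that corner_mixed_difference[of G i j] G0 by simp
  \<comment> \<open>The values \<open>c = 1\<close> and \<open>c = -1\<close> give two points of the
    polytope with midpoint \<open>X\<close>; extremality then forces \<open>D = 0\<close>.\<close>
  have pert: "X + c *\<^sub>R D \<in> vhs_set k e" if "\<bar>c\<bar> \<le> 1" for c
  proof -
    have "vhs_corner k (corner (entry e (X + c *\<^sub>R D)))"
      by (rule vhs_corner_cong[OF _ vhs_corner_perturb[OF h that]])
        (simp add: entry_add_scaleR corner_add_mult cD h_def G_def)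
    then show ?thesis by (simp add: vhs_set_def)
  qed
  have "D = 0"
  proof (rule ccontr)
    assume D: "D \<noteq> 0"
    have "X + D \<noteq> X - D"
    proof
      assume "X + D = X - D"
      then have "2 *\<^sub>R D = 0" by (simp add: scaleR_2 algebra_simps)
      with D show False by simp
    qed
    moreover have "midpoint (X + D) (X - D) = X"
      by (simp add: midpoint_def scaleR_add_right flip: scaleR_2)
    ultimately have "X \<in> open_segment (X + D) (X - D)"
      by (metis midpoint_in_open_segment)
    moreover have "X + D \<in> vhs_set k e" "X - D \<in> vhs_set k e"
      using pert[of 1] pert[of "-1"] by auto
    ultimately show False using X unfolding extreme_point_of_def by blast
  qed
  \<comment> \<open>With \<open>D = 0\<close> the signed bump vanishes, and \<open>bump\<close> is
    zero only at integers.\<close>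
  have ints: "h i j \<in> \<int>" if "i \<le> 2*k+1" "j \<le> 2*k+1" for i j
  proof -
    have "G i j = 0"
      using cD[OF that] \<open>D = 0\<close> by (simp add: corner_def psum_def entry_def)
    then show ?thesis by (auto simp: G_def signed_bump_def bump_eq_0_iff split: if_splits)
  qed
  have int01: "r \<in> {0, 1}" if "r \<in> \<int>" "r \<in> {0..1}" for r :: real
    using that by (auto elim!: Ints_cases)
  note P = vhs_corner_psum[OF h[unfolded h_def]]
  have "psum (entry e X i) j \<in> \<int>" if ij: "i \<in> {1..2*k+1}" "j \<le> 2*k+1" for i j
  proof -
    obtain a where a: "i = Suc a" using ij by (cases i) auto
    have "psum (entry e X i) j = h i j - h a j" by (simp add: a h_def corner_Suc_row)
    then show ?thesis using ints ij a by simp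
  qed
  moreover have "psum (\<lambda>i. entry e X i j) i \<in> \<int>" if ij: "j \<in> {1..2*k+1}" "i \<le> 2*k+1" for i j
  proof -
    obtain b where b: "j = Suc b" using ij by (cases j) auto
    have "psum (\<lambda>i. entry e X i j) i = h i j - h i b" by (simp add: b h_def corner_Suc_col)
    then show ?thesis using ints ij b by simp
  qed
  ultimately have asm: "X \<in> ASM (2*k+1) e"
    unfolding ASM_iff using P int01 by blast
  have refl: "h i (2*k+1 - j) = real i - h i j" "h (2*k+1 - i) j = real j - h i j"
    if "i \<le> 2*k+1" "j \<le> 2*k+1" for i j
    using that by (rule vhs_cornerD[OF h])+
  have ent: "entry e X (Suc a) (Suc b) = h (Suc a) (Suc b) - h a (Suc b) - h (Suc a) b + h a b" for a b
    using entry_eq_corner[of "Suc a" "Suc b" "entry e X"] by (simp add: h_def)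
  have "entry e X i j = entry e X i (2*k+1 + 1 - j) \<and> entry e X i j = entry e X (2*k+1 + 1 - i) j"
    if ij: "i \<in> {1..2*k+1}" "j \<in> {1..2*k+1}" for i j
  proof -
    obtain a b where ab: "i = Suc a" "j = Suc b" using ij by (cases i; cases j) auto
    \<comment> \<open>Entries reflect in \<open>2*k+2\<close> but corner indices in
      \<open>2*k+1\<close>: the two corner columns \<open>b\<close> and \<open>j\<close> bounding
      entry column \<open>j\<close> go to those bounding its mirror image, in reverse order. Rows
      behave alike.\<close>
    have "2*k+1 + 1 - j = Suc (2*k+1 - j)" "2*k+1 + 1 - i = Suc (2*k+1 - i)"
      "Suc (2*k+1 - j) = 2*k+1 - b" "Suc (2*k+1 - i) = 2*k+1 - a"
      using ij ab by auto
    then show ?thesis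
      using ij ab ent[of a b] ent[of a "2*k+1 - j"] ent[of "2*k+1 - i" b]
        refl[of i j] refl[of i b] refl[of a j] refl[of a b]
      by simp
  qed
  then have "X \<in> P_VS (2*k+1) e \<inter> P_HS (2*k+1) e"
    unfolding symmetric_entry Int_iff by blast
  with asm show ?thesis by (simp add: VHSASM_def)
qed

lemma vhs_set_subset_P_VHSASM:
  fixes e :: "nat \<Rightarrow> 'n::finite"
  assumes e: "bij_betw e {1..2*k+1} (UNIV :: 'n set)"
  shows "vhs_set k e \<subseteq> P_VHSASM (2*k+1) e"
proof -
  have "compact (vhs_set k e)"
    using closed_vhs_set bounded_vhs_set[OF e] compact_eq_bounded_closed by blast
  then have "vhs_set k e = convex hull {X. X extreme_point_of vhs_set k e}"
    using Krein_Milman_Minkowski convex_vhs_set by blast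
  also have "\<dots> \<subseteq> P_VHSASM (2*k+1) e"
    unfolding P_VHSASM_def using extreme_point_vhs_set[OF e] by (intro hull_mono) auto
  finally show ?thesis .
qed

section \<open>The two inclusions\<close>

lemma convex_symmetric_middle:
  "convex (P_ASM n e \<inter> P_VS n e \<inter> P_HS n e \<inter>
    {X. \<forall>i\<in>{1..n}. X $ e i $ e m = c i \<and> X $ e m $ e i = c i})"
proof -
  have "convex (P_VS n e)" "convex (P_HS n e)"
    by (auto simp: convex_def P_VS_def P_HS_def)
  moreover have "convex {X. \<forall>i\<in>{1..n}. X $ e i $ e m = c i \<and> X $ e m $ e i = c i}"
    by (auto simp: convex_def simp flip: distrib_right)
  ultimately show ?thesis
    unfolding P_ASM_def by (intro convex_Int convex_convex_hull)
qed

theorem theorem4p5: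
  fixes n k :: nat and e :: "nat \<Rightarrow> 'n::finite"
  assumes "n \<ge> 1"
    and "bij_betw e {1..n} (UNIV :: 'n set)"
    and "k = n div 2"
  shows "P_VHSASM n e = P_ASM n e \<inter> P_VS n e \<inter> P_HS n e \<inter>
    {X :: real^'n^'n. \<forall>i\<in>{1..n}. X $ e i $ e (k + 1) = (-1) ^ (i + 1) \<and>
                                    X $ e (k + 1) $ e i = (-1) ^ (i + 1)}"
    (is "_ = ?R")
proof (cases "even n")
  case True
  then have n: "n = 2 * k" using assms by simp
  \<comment> \<open>For even \<open>n\<close> the two halves of the first row have equal sums in {0,
    1}, which cannot add up to 1.\<close>
  have "X \<notin> VHSASM n e" for X
  proof
    assume X: "X \<in> VHSASM n e"
    have one: "1 \<in> {1..n}" "k \<le> n" using assms(1) n by auto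
    have "psum (entry e X 1) (n - k) = psum (entry e X 1) n - psum (entry e X 1) k"
      using X one unfolding VHSASM_def symmetric_entry Int_iff by (intro psum_reflect) blast+
    moreover have "psum (entry e X 1) n = 1" "psum (entry e X 1) k \<in> {0, 1}"
      using X one unfolding VHSASM_def ASM_iff Int_iff by blast+
    ultimately show False using n by auto
  qed
  then have "P_VHSASM n e = {}" by (auto simp: P_VHSASM_def)
  \<comment> \<open>Column \<open>k+1\<close> has sum 1 in \<open>P_ASM\<close>, whereas its
    prescribed signs cancel over an even number of rows.\<close>
  moreover have "X \<notin> ?R" for X
  proof
    assume X: "X \<in> ?R"
    have "psum (\<lambda>i. entry e X i (k + 1)) n = 1"
      using X assms(1) n by (intro P_ASM_psum(4)) auto
    moreover have "psum (\<lambda>i. entry e X i (k + 1)) n = psum (\<lambda>i. (-1) ^ (i + 1)) n"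
      unfolding psum_def using X by (intro sum.cong) (auto simp: entry_def)
    ultimately show False using True by (simp add: psum_minus_one_power del: One_nat_def)
  qed
  ultimately show ?thesis by blast
next
  case False
  then have n: "n = 2 * k + 1" using assms by presburger
  show ?thesis
  proof
    \<comment> \<open>As the right-hand side is convex, it suffices to place the VHSASMs themselves
      in it.\<close>
    have "VHSASM n e \<subseteq> ?R"
    proof
      fix X assume X: "X \<in> VHSASM n e"
      then have asm: "X \<in> ASM n e" and sym: "X \<in> P_VS n e" "X \<in> P_HS n e"
        by (auto simp: VHSASM_def)
      have "entry e X i (k + 1) = (-1) ^ (i + 1)" "entry e X (k + 1) i = (-1) ^ (i + 1)"
        if "i \<in> {1..n}" for i
      proof -
        have k: "k + 1 \<in> {1..n}" "k \<le> n" using n by auto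
        show "entry e X i (k + 1) = (-1) ^ (i + 1)"
          using asm[unfolded ASM_iff] sym(1)[unfolded symmetric_entry] that k unfolding n
          by (intro symmetric_alternating_middle[of k "entry e X"]) blast+
        show "entry e X (k + 1) i = (-1) ^ (i + 1)"
          using asm[unfolded ASM_iff] sym(2)[unfolded symmetric_entry] that k unfolding n
          by (intro symmetric_alternating_middle[of k "\<lambda>i j. entry e X j i"]) blast+
      qed
      then show "X \<in> ?R"
        using asm sym hull_inc[OF asm] by (auto simp: P_ASM_def entry_def)
    qed
    then show "P_VHSASM n e \<subseteq> ?R"
      unfolding P_VHSASM_def by (rule hull_minimal) (rule convex_symmetric_middle)
  next
    have "?R \<subseteq> vhs_set k e"
    proof
      fix X assume X: "X \<in> ?R"
      define x where "x = entry e X"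
      note P = P_ASM_psum[of X n e, folded x_def]
      have P1: "X \<in> P_ASM n e" using X by blast
      have sym: "x i j = x i (n + 1 - j)" "x i j = x (n + 1 - i) j"
        if "i \<in> {1..n}" "j \<in> {1..n}" for i j
        using X that unfolding x_def Int_iff symmetric_entry by blast+
      have mid: "x i (k + 1) = (-1) ^ (i + 1)" "x (k + 1) i = (-1) ^ (i + 1)" if "i \<in> {1..n}" for i
        using X that unfolding x_def entry_def by blast+
      have refl: "corner x i (n - j) = real i - corner x i j" "corner x (n - j) i = real i - corner x j i"
        if "i \<le> n" "j \<le> n" for i j
        using corner_reflect_col[of n x i j, OF P(3)[OF P1] sym(1)]
          corner_reflect_col[of n "\<lambda>i j. x j i" i j, OF P(4)[OF P1] sym(2)] that
        by (simp_all add: corner_transpose[of x])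
      have half: "corner x i k = real (i div 2)" "corner x k i = real (i div 2)" if "i \<le> n" for i
        using corner_half_col[of k x i, folded n, OF P(3)[OF P1] sym(1) mid(1)]
          corner_half_col[of k "\<lambda>i j. x j i" i, folded n, OF P(4)[OF P1] sym(2) mid(2)] that
        by (simp_all add: corner_transpose[of x])
      have "vhs_corner k (corner x)"
        by (rule vhs_cornerI; unfold n[symmetric])
          (use refl half P(1,2)[OF P1] in \<open>auto simp: corner_Suc_row corner_Suc_col\<close>)
      then show "X \<in> vhs_set k e" by (simp add: vhs_set_def x_def)
    qed
    also have "\<dots> \<subseteq> P_VHSASM n e"
      using vhs_set_subset_P_VHSASM assms(2) unfolding n by blast
    finally show "?R \<subseteq> P_VHSASM n e" .
  qed
qed

end
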